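(* Consider the single-frequency RoPE phase flow on the circle with $n\ge 2$ tokens at consecutive integer positions $p_j=j$, $j=0,\dots,n-1$, finite $\beta\ge0$ and frequency $\omega\in\mathbb{R}$. For $c\in\mathbb{R}$, the twisted configuration $$\theta_j=c-\omega j\pmod{2\pi},\qquad j=0,\dots,n-1,$$ is an equilibrium if and only if $$\omega\in\pi\mathbb{Z}\qquad\text{or}\qquad n\omega\in2\pi\mathbb{Z}.\qquad( * )$$ If $\omega$ is an odd multiple of $\pi$ the configuration is bipodal (the tokens occupy two antipodal points); if $\omega$ is an even multiple of $\pi$ it is consensus. Outside $( * )$, for every fixed $\omega\notin2\pi\mathbb{Z}$, the velocities at the twisted configuration satisfy $$\max_i|\dot\theta_i|\le\frac{|\sin(n\omega/2)|}{n|\sin(\omega/2)|}\le\frac{1}{n|\sin(\omega/2)|}=O_\omega(n^{-1}).$$ The constant is not uniform when $\omega$ varies with $n$ toward $2\pi\mathbb{Z}$: for no $C<\infty$ and $\varepsilon>0$ does $\max_i|\dot\theta_i|\le C/n$ hold for all $n\ge2$ and all $\omega$ violating $( * )$ with $\operatorname{dist}(\omega,2\pi\mathbb{Z})<\varepsilon$.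
   Context: Phase flow: for phases $\theta=(\theta_0,\dots,\theta_{n-1})$, positions $p_j=j$, frequency $\omega$, finite $\beta\ge0$, let $W_{ij}=\exp\bigl(\beta\cos(\theta_i-\theta_j+\omega(p_i-p_j))\bigr)$, $A_{ij}=W_{ij}/\sum_kW_{ik}$, and $\dot\theta_i=\sum_jA_{ij}(\theta)\sin(\theta_j-\theta_i)$. (This is self-attention with rotary position embedding on $\mathbb{S}^1$, $x_j=(\cos\theta_j,\sin\theta_j)$.) An equilibrium is a configuration at which all $\dot\theta_i=0$. *)

theory Defs
  imports "HOL-Analysis.Analysis" "HOL-Library.Real_Mod" "HOL-Library.Landau_Symbols"
begin

text \<open>
  A configuration of \<open>n\<close> tokens is given by phases \<open>\<theta> :: nat \<Rightarrow> real\<close>, of which only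
  \<open>\<theta> 0, \<dots>, \<theta> (n - 1)\<close> matter. The phases are real representatives of angles modulo
  \<open>2 * pi\<close>. The token with index \<open>j\<close> sits at the integer position \<open>j\<close>.
\<close>

definition rope_weight :: "real \<Rightarrow> real \<Rightarrow> (nat \<Rightarrow> real) \<Rightarrow> nat \<Rightarrow> nat \<Rightarrow> real" where
  "rope_weight \<beta> \<omega> \<theta> i j = exp (\<beta> * cos (\<theta> i - \<theta> j + \<omega> * (real i - real j)))"

definition rope_attention ::
    "nat \<Rightarrow> real \<Rightarrow> real \<Rightarrow> (nat \<Rightarrow> real) \<Rightarrow> nat \<Rightarrow> nat \<Rightarrow> real" where
  "rope_attention n \<beta> \<omega> \<theta> i j =
     rope_weight \<beta> \<omega> \<theta> i j / (\<Sum>k<n. rope_weight \<beta> \<omega> \<theta> i k)"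

text \<open>The vector field of the phase flow, i.e. the right-hand side of the ODE for \<open>\<theta> i\<close>.\<close>

definition rope_velocity :: "nat \<Rightarrow> real \<Rightarrow> real \<Rightarrow> (nat \<Rightarrow> real) \<Rightarrow> nat \<Rightarrow> real" where
  "rope_velocity n \<beta> \<omega> \<theta> i =
     (\<Sum>j<n. rope_attention n \<beta> \<omega> \<theta> i j * sin (\<theta> j - \<theta> i))"

definition rope_equilibrium :: "nat \<Rightarrow> real \<Rightarrow> real \<Rightarrow> (nat \<Rightarrow> real) \<Rightarrow> bool" where
  "rope_equilibrium n \<beta> \<omega> \<theta> \<longleftrightarrow> (\<forall>i<n. rope_velocity n \<beta> \<omega> \<theta> i = 0)"

text \<open>Only meaningful for \<open>n > 0\<close>, as the maximum of the empty set is unspecified.\<close>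

definition rope_max_speed :: "nat \<Rightarrow> real \<Rightarrow> real \<Rightarrow> (nat \<Rightarrow> real) \<Rightarrow> real" where
  "rope_max_speed n \<beta> \<omega> \<theta> = Max ((\<lambda>i. \<bar>rope_velocity n \<beta> \<omega> \<theta> i\<bar>) ` {..<n})"

definition twisted :: "nat \<Rightarrow> real \<Rightarrow> real \<Rightarrow> (nat \<Rightarrow> real) \<Rightarrow> bool" where
  "twisted n \<omega> c \<theta> \<longleftrightarrow> (\<forall>j<n. [\<theta> j = c - \<omega> * real j] (rmod (2 * pi)))"

definition int_multiples :: "real \<Rightarrow> real set" where
  "int_multiples a = range (\<lambda>k :: int. a * of_int k)"

definition resonant :: "nat \<Rightarrow> real \<Rightarrow> bool" where
  "resonant n \<omega> \<longleftrightarrow> \<omega> \<in> int_multiples pi \<or> real n * \<omega> \<in> int_multiples (2 * pi)"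

definition token :: "real \<Rightarrow> real \<times> real" where
  "token t = (cos t, sin t)"

text \<open>
  The points \<open>u\<close> and \<open>- u\<close> below are automatically distinct points of the unit circle, and
  the set equality says that both are occupied.
\<close>

definition bipodal :: "nat \<Rightarrow> (nat \<Rightarrow> real) \<Rightarrow> bool" where
  "bipodal n \<theta> \<longleftrightarrow> (\<exists>u. (\<lambda>j. token (\<theta> j)) ` {..<n} = {u, - u})"

definition consensus :: "nat \<Rightarrow> (nat \<Rightarrow> real) \<Rightarrow> bool" where
  "consensus n \<theta> \<longleftrightarrow> (\<exists>u. \<forall>j<n. token (\<theta> j) = u)"

end

theory Submission
  imports Defs
begin

text \<open>
  At a twisted configuration the rotary phases \<open>\<theta> j + \<omega> j\<close> all agree modulo \<open>2 * pi\<close>, so every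
  attention score equals \<open>exp \<beta>\<close> and attention is uniform, whatever \<open>\<beta>\<close> is. The velocity of
  token \<open>i\<close> is therefore the average of \<open>sin (\<omega> (i - j))\<close> over \<open>j < n\<close>. This sine sum over an
  arithmetic progression telescopes once it is multiplied by \<open>sin (\<omega> / 2)\<close>
  (\<open>sin_half_mult_sum_sin\<close>), which gives
  \[ \dot\theta_i = \frac{\sin(n\omega/2)\,\sin(\omega(i-(n-1)/2))}{n\,\sin(\omega/2)}. \]

  The rest is read off from this formula (\<open>twisted_velocity_closed_form\<close>). Bounding the second
  sine by 1 gives the speed estimate. For \<open>\<omega>\<close> outside \<open>2 * pi * \<int>\<close>, an equilibrium needs
  \<open>sin (n \<omega> / 2) = 0\<close>, or else the second sine must vanish for \<open>i = 0\<close> and for \<open>i = 1\<close>; the two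
  arguments differ by \<open>\<omega>\<close>, so then \<open>sin \<omega> = 0\<close>. Together with the direct check of the
  multiples of \<open>pi\<close> this is the resonance condition. Finally, along \<open>\<omega> = 1 / n\<close> the numerator at \<open>i = 0\<close>
  stays away from 0 while the denominator \<open>n * sin (\<omega> / 2)\<close> stays bounded, so the speed does not
  tend to 0 although \<open>\<omega>\<close> does; this excludes a bound \<open>C / n\<close> that is uniform near \<open>2 * pi * \<int>\<close>.
\<close>

section \<open>Resonance in terms of sines\<close>

lemma int_multiples_pi_iff: "x \<in> int_multiples pi \<longleftrightarrow> sin x = 0"
  unfolding int_multiples_def by (auto simp: sin_zero_iff_int2 mult.commute)

lemma int_multiples_two_pi_iff: "x \<in> int_multiples (2 * pi) \<longleftrightarrow> sin (x / 2) = 0"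
  unfolding int_multiples_def by (auto simp: sin_zero_iff_int2 mult_ac)

lemma resonant_iff_sin:
  "resonant n \<omega> \<longleftrightarrow> sin \<omega> = 0 \<or> sin (real n * \<omega> / 2) = 0"
  by (simp add: resonant_def int_multiples_pi_iff int_multiples_two_pi_iff)

section \<open>Velocities at a twisted configuration\<close>

lemma twistedE:
  assumes "twisted n \<omega> c \<theta>" "j < n"
  obtains k :: int where "\<theta> j = c - \<omega> * real j + 2 * pi * of_int k"
proof -
  have "[c - \<omega> * real j = \<theta> j] (rmod (2 * pi))"
    using assms by (auto simp: twisted_def rcong_sym)
  then obtain k :: int where "\<theta> j = c - \<omega> * real j + of_int k * (2 * pi)"
    by (auto simp: rcong_altdef)
  then show thesis
    using that[of k] by (simp add: mult_ac)
qed

text \<open>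
  The twist cancels the rotation: relative rotary phases are multiples of \<open>2 * pi\<close>, so all scores
  take the same value and the normalised weights are uniform.
\<close>

lemma twisted_weight:
  assumes "twisted n \<omega> c \<theta>" "i < n" "j < n"
  shows "rope_weight \<beta> \<omega> \<theta> i j = exp \<beta>"
proof -
  obtain k where k: "\<theta> i = c - \<omega> * real i + 2 * pi * of_int k"
    using twistedE[OF assms(1,2)] by blast
  obtain l where l: "\<theta> j = c - \<omega> * real j + 2 * pi * of_int l"
    using twistedE[OF assms(1,3)] by blast
  have "\<theta> i - \<theta> j + \<omega> * (real i - real j) = 2 * pi * of_int (k - l)"
    unfolding k l by (simp add: algebra_simps)
  then show ?thesis
    by (simp only: rope_weight_def cos_int_2pin mult_1_right)
qed

lemma twisted_attention:
  assumes "twisted n \<omega> c \<theta>" "i < n" "j < n"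
  shows "rope_attention n \<beta> \<omega> \<theta> i j = 1 / real n"
proof -
  have "(\<Sum>k<n. rope_weight \<beta> \<omega> \<theta> i k) = (\<Sum>k<n. exp \<beta>)"
    using assms by (intro sum.cong) (auto simp: twisted_weight)
  then show ?thesis
    using assms by (simp add: rope_attention_def twisted_weight)
qed

lemma twisted_velocity:
  assumes "twisted n \<omega> c \<theta>" "i < n"
  shows "rope_velocity n \<beta> \<omega> \<theta> i = (\<Sum>j<n. sin (\<omega> * (real i - real j))) / real n"
proof -
  obtain k where k: "\<theta> i = c - \<omega> * real i + 2 * pi * of_int k"
    using twistedE[OF assms] by blast
  have "sin (\<theta> j - \<theta> i) = sin (\<omega> * (real i - real j))" if j: "j < n" for j
  proof -
    obtain l where l: "\<theta> j = c - \<omega> * real j + 2 * pi * of_int l"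
      using twistedE[OF assms(1) j] by blast
    have "\<theta> j - \<theta> i = \<omega> * (real i - real j) + 2 * pi * of_int (l - k)"
      unfolding k l by (simp add: algebra_simps)
    then show ?thesis
      by (simp only: sin_add cos_int_2pin sin_int_2pin mult_1_right mult_zero_right add_0_right)
  qed
  then show ?thesis
    using assms by (simp add: rope_velocity_def twisted_attention sum_divide_distrib)
qed

text \<open>
  By the product formula, \<open>2 sin (\<omega> / 2) sin (\<omega> (x - j))\<close> is the difference of the values
  of \<open>cos (\<omega> (x + 1 / 2 - t))\<close> at \<open>t = j + 1\<close> and \<open>t = j\<close>, so the sum telescopes.
\<close>

lemma sin_half_mult_sum_sin:
  fixes \<omega> x :: real
  shows "sin (\<omega> / 2) * (\<Sum>j<n. sin (\<omega> * (x - real j))) =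
    sin (real n * \<omega> / 2) * sin (\<omega> * (x - (real n - 1) / 2))"
proof -
  define g where "g t = cos (\<omega> * (x + 1 / 2 - real t))" for t
  have step: "2 * (sin (\<omega> / 2) * sin (\<omega> * (x - real j))) = g (Suc j) - g j" for j
  proof -
    have "\<omega> * (x + 1 / 2 - real (Suc j)) = \<omega> * (x - real j) - \<omega> / 2"
      "\<omega> * (x + 1 / 2 - real j) = \<omega> * (x - real j) + \<omega> / 2"
      by (simp_all add: algebra_simps)
    then show ?thesis
      by (simp only: g_def cos_add cos_diff) simp
  qed
  have "2 * (sin (\<omega> / 2) * (\<Sum>j<n. sin (\<omega> * (x - real j)))) = (\<Sum>j<n. g (Suc j) - g j)"
    by (simp only: sum_distrib_left step)
  also have "\<dots> = g n - g 0"
    by (rule sum_lessThan_telescope)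
  also have "\<dots> = 2 * (sin (real n * \<omega> / 2) * sin (\<omega> * (x - (real n - 1) / 2)))"
  proof -
    have "\<omega> * (x + 1 / 2 - real n) = \<omega> * (x - (real n - 1) / 2) - real n * \<omega> / 2"
      "\<omega> * (x + 1 / 2 - real 0) = \<omega> * (x - (real n - 1) / 2) + real n * \<omega> / 2"
      by (simp_all add: field_simps)
    then show ?thesis
      by (simp only: g_def cos_add cos_diff) simp
  qed
  finally show ?thesis
    by simp
qed

lemma twisted_velocity_closed_form:
  assumes "twisted n \<omega> c \<theta>" "i < n" "sin (\<omega> / 2) \<noteq> 0"
  shows "rope_velocity n \<beta> \<omega> \<theta> i =
    sin (real n * \<omega> / 2) * sin (\<omega> * (real i - (real n - 1) / 2)) / (real n * sin (\<omega> / 2))"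
  using assms sin_half_mult_sum_sin[of \<omega> "real i" n]
  by (simp add: twisted_velocity field_simps)

section \<open>Equilibria\<close>

lemma sin_eq_0_imp_sin_int_mult_eq_0:
  fixes x :: real
  assumes "sin x = 0"
  shows "sin (x * of_int m) = 0"
proof -
  obtain k :: int where "x = of_int k * pi"
    using assms by (auto simp: sin_zero_iff_int2)
  then have "x * of_int m = of_int (k * m) * pi"
    by simp
  then show ?thesis
    using sin_zero_iff_int2 by blast
qed

lemma twisted_equilibrium_iff:
  assumes "n \<ge> 2" "twisted n \<omega> c \<theta>"
  shows "rope_equilibrium n \<beta> \<omega> \<theta> \<longleftrightarrow> resonant n \<omega>"
proof (cases "sin \<omega> = 0")
  case True
  have "sin (\<omega> * (real i - real j)) = 0" for i j
    using sin_eq_0_imp_sin_int_mult_eq_0[OF True, of "int i - int j"] by simp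
  then show ?thesis
    using True assms by (simp add: rope_equilibrium_def resonant_iff_sin twisted_velocity)
next
  case False
  have half: "sin (\<omega> / 2) \<noteq> 0"
    using False sin_double[of "\<omega> / 2"] by auto
  show ?thesis
  proof
    assume eq: "rope_equilibrium n \<beta> \<omega> \<theta>"
    show "resonant n \<omega>"
    proof (rule ccontr)
      assume "\<not> resonant n \<omega>"
      then have nz: "sin (real n * \<omega> / 2) \<noteq> 0"
        by (simp add: resonant_iff_sin)
      let ?a = "\<lambda>i. \<omega> * (real i - (real n - 1) / 2)"
      have a: "sin (?a i) = 0" if "i < n" for i
        using eq that nz half assms twisted_velocity_closed_form[OF assms(2) that half, of \<beta>]
        by (auto simp: rope_equilibrium_def)
      have "sin (?a 1 - ?a 0) = 0"
        unfolding sin_diff using a[of 0] a[of 1] assms(1) by simp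
      moreover have "?a 1 - ?a 0 = \<omega>"
        by (simp add: algebra_simps)
      ultimately show False
        using False by simp
    qed
  next
    assume "resonant n \<omega>"
    then have "sin (real n * \<omega> / 2) = 0"
      using False by (simp add: resonant_iff_sin)
    then show "rope_equilibrium n \<beta> \<omega> \<theta>"
      using assms(2) half by (simp add: rope_equilibrium_def twisted_velocity_closed_form)
  qed
qed

section \<open>Consensus and bipodal configurations\<close>

lemma twisted_token:
  assumes "twisted n \<omega> c \<theta>" "j < n"
  shows "token (\<theta> j) = token (c - \<omega> * real j)"
proof -
  obtain k where "\<theta> j = c - \<omega> * real j + 2 * pi * of_int k"
    using twistedE[OF assms] by blast
  then show ?thesis
    by (simp only: token_def cos_add sin_add cos_int_2pin sin_int_2pin) simp
qed

lemma token_minus_int_pi: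
  "token (x - pi * of_int m) = (if even m then token x else - token x)"
proof -
  have "sin (pi * of_int m) = 0" "cos (pi * of_int m) = (if even m then 1 else - 1)"
    by (auto simp: sin_zero_iff_int2 mult.commute cos_int_times_real sin_int_times_real)
  then show ?thesis
    by (auto simp: token_def cos_diff sin_diff)
qed

lemma twisted_pi_token:
  assumes "twisted n (pi * of_int k) c \<theta>" "j < n"
  shows "token (\<theta> j) = (if even (k * int j) then token c else - token c)"
  using twisted_token[OF assms] token_minus_int_pi[of c "k * int j"] by (simp add: mult.assoc)

lemma twisted_odd_bipodal:
  assumes "n \<ge> 2" "twisted n (pi * of_int k) c \<theta>" "odd k"
  shows "bipodal n \<theta>"
proof -
  have tok: "token (\<theta> j) = (if even j then token c else - token c)" if "j < n" for j
    using twisted_pi_token[OF assms(2) that] assms(3) by simp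
  have "(\<lambda>j. token (\<theta> j)) ` {..<n} = {token c, - token c}"
  proof
    show "(\<lambda>j. token (\<theta> j)) ` {..<n} \<subseteq> {token c, - token c}"
      using tok by auto
    have "token c = token (\<theta> 0)" "- token c = token (\<theta> 1)"
      using tok[of 0] tok[of 1] assms(1) by auto
    then show "{token c, - token c} \<subseteq> (\<lambda>j. token (\<theta> j)) ` {..<n}"
      using assms(1) by auto
  qed
  then show ?thesis
    unfolding bipodal_def by (rule exI)
qed

lemma twisted_even_consensus:
  assumes "twisted n (pi * of_int k) c \<theta>" "even k"
  shows "consensus n \<theta>"
  unfolding consensus_def using twisted_pi_token[OF assms(1)] assms(2) by auto

section \<open>Speed bounds for fixed frequency\<close>

lemma twisted_max_speed_le:
  assumes "n > 0" "twisted n \<omega> c \<theta>" "sin (\<omega> / 2) \<noteq> 0"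
  shows "rope_max_speed n \<beta> \<omega> \<theta> \<le> \<bar>sin (real n * \<omega> / 2)\<bar> / (real n * \<bar>sin (\<omega> / 2)\<bar>)"
proof -
  have "\<bar>rope_velocity n \<beta> \<omega> \<theta> i\<bar> \<le> \<bar>sin (real n * \<omega> / 2)\<bar> / (real n * \<bar>sin (\<omega> / 2)\<bar>)"
    if "i < n" for i
    unfolding twisted_velocity_closed_form[OF assms(2) that assms(3)]
    by (auto simp: abs_mult intro!: divide_right_mono mult_left_le)
  then show ?thesis
    using assms(1) unfolding rope_max_speed_def by (subst Max_le_iff) auto
qed

lemma abs_sin_divide_le:
  fixes x d :: real
  assumes "d \<ge> 0"
  shows "\<bar>sin x\<bar> / d \<le> 1 / d"
  using assms by (intro divide_right_mono) auto

lemma abs_velocity_le_max_speed: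
  assumes "i < n"
  shows "\<bar>rope_velocity n \<beta> \<omega> \<theta> i\<bar> \<le> rope_max_speed n \<beta> \<omega> \<theta>"
  using assms unfolding rope_max_speed_def by (intro Max_ge) auto

section \<open>Failure of uniformity near zero frequency\<close>

text \<open>
  Frequency \<open>1 / n\<close> makes \<open>n \<omega> = 1\<close> a fixed non-resonant angle, while \<open>n sin (\<omega> / 2) \<le> 1 / 2\<close>.
  Token 0 already moves fast: all other tokens lie on one side of it, at angles up to about 1.
  The angle \<open>1 / 4\<close> is the value of \<open>\<omega> (n - 1) / 2\<close> at \<open>n = 2\<close>, where it is smallest.
\<close>

lemma max_speed_inverse_frequency_ge:
  assumes "n \<ge> 2" "twisted n (1 / real n) c \<theta>"
  shows "rope_max_speed n \<beta> (1 / real n) \<theta> \<ge> 2 * sin (1 / 2) * sin (1 / 4)"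
proof -
  define \<omega> where "\<omega> = 1 / real n"
  have n: "real n \<ge> 2" "real n * \<omega> = 1"
    using assms(1) by (auto simp: \<omega>_def)
  have \<omega>: "0 < \<omega>" "\<omega> \<le> 1"
    using n(1) by (auto simp: \<omega>_def)
  have half: "sin (\<omega> / 2) > 0"
    using \<omega> pi_gt3 by (intro sin_gt_zero) auto
  have d: "0 < real n * sin (\<omega> / 2)" "real n * sin (\<omega> / 2) \<le> 1 / 2"
  proof -
    show "0 < real n * sin (\<omega> / 2)"
      using half n(1) by simp
    have "real n * sin (\<omega> / 2) \<le> real n * (\<omega> / 2)"
      using \<omega>(1) by (intro mult_left_mono sin_x_le_x) auto
    then show "real n * sin (\<omega> / 2) \<le> 1 / 2"
      using n(2) by simp
  qed
  define y where "y = \<omega> * ((real n - 1) / 2)"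
  have y_eq: "y = (1 - \<omega>) / 2"
    using n(2) by (simp add: y_def algebra_simps)
  have "\<omega> \<le> 1 / 2"
    using n(1) by (simp add: \<omega>_def field_simps)
  then have y: "1 / 4 \<le> y" "y \<le> 1 / 2"
    using \<omega> by (auto simp: y_eq)
  have s12: "sin (1 / 2 :: real) > 0" and s14: "sin (1 / 4 :: real) > 0"
    using pi_gt3 by (auto intro!: sin_gt_zero)
  have siny: "sin (1 / 4) \<le> sin y"
    using y pi_gt3 by (intro sin_monotone_2pi_le) auto
  have "rope_velocity n \<beta> \<omega> \<theta> 0 = sin (1 / 2) * sin (- y) / (real n * sin (\<omega> / 2))"
    using twisted_velocity_closed_form[of n \<omega> c \<theta> 0 \<beta>] assms half n(2)
    by (simp add: \<omega>_def[symmetric] y_def)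
  then have v: "\<bar>rope_velocity n \<beta> \<omega> \<theta> 0\<bar> = sin (1 / 2) * sin y / (real n * sin (\<omega> / 2))"
    using s12 s14 siny half by (simp add: abs_mult abs_divide)
  have "2 * sin (1 / 2) * sin (1 / 4) = sin (1 / 2) * sin (1 / 4) / (1 / 2 :: real)"
    by simp
  also have "\<dots> \<le> sin (1 / 2) * sin y / (real n * sin (\<omega> / 2))"
    using s12 s14 siny d by (intro frac_le mult_left_mono mult_nonneg_nonneg) auto
  also have "\<dots> \<le> rope_max_speed n \<beta> \<omega> \<theta>"
    using abs_velocity_le_max_speed[of 0 n \<beta> \<omega> \<theta>] assms(1) v by simp
  finally show ?thesis
    by (simp add: \<omega>_def)
qed

lemma not_resonant_inverse_frequency:
  assumes "n \<ge> 2"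
  shows "\<not> resonant n (1 / real n)"
proof -
  have "0 < 1 / real n" "1 / real n \<le> 1"
    using assms by auto
  then have "0 < 1 / real n" "1 / real n < pi"
    using pi_gt3 by linarith+
  then have "sin (1 / real n) > 0"
    by (rule sin_gt_zero)
  moreover have "sin (1 / 2 :: real) > 0"
    using pi_gt3 by (intro sin_gt_zero) auto
  ultimately show ?thesis
    using assms by (auto simp: resonant_iff_sin)
qed

lemma no_uniform_speed_bound:
  assumes "\<epsilon> > 0"
  shows "\<exists>n \<omega> \<theta>. n \<ge> 2 \<and> \<not> resonant n \<omega> \<and> infdist \<omega> (int_multiples (2 * pi)) < \<epsilon> \<and>
    twisted n \<omega> c \<theta> \<and> rope_max_speed n \<beta> \<omega> \<theta> > C / real n"
proof -
  define \<delta> :: real where "\<delta> = 2 * sin (1 / 2) * sin (1 / 4)"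
  have \<delta>: "\<delta> > 0"
    unfolding \<delta>_def using pi_gt3 by (intro mult_pos_pos sin_gt_zero) auto
  obtain n :: nat where "real n > max 2 (max (1 / \<epsilon>) (C / \<delta>))"
    using reals_Archimedean2 by blast
  then have n: "n \<ge> 2" "1 / real n < \<epsilon>" "C / real n < \<delta>"
    using assms \<delta> by (auto simp: field_simps)
  define \<theta> where "\<theta> j = c - 1 / real n * real j" for j
  have tw: "twisted n (1 / real n) c \<theta>"
    by (simp add: twisted_def \<theta>_def)
  have "0 \<in> int_multiples (2 * pi)"
    by (simp add: int_multiples_two_pi_iff)
  then have "infdist (1 / real n) (int_multiples (2 * pi)) \<le> dist (1 / real n) 0"
    by (rule infdist_le)
  then have "infdist (1 / real n) (int_multiples (2 * pi)) < \<epsilon>"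
    using n(2) by simp
  then show ?thesis
    using n tw not_resonant_inverse_frequency[OF n(1)]
      max_speed_inverse_frequency_ge[OF n(1) tw, of \<beta>]
    unfolding \<delta>_def by (meson less_le_trans)
qed

section \<open>Twisted configurations of the rotary phase flow\<close>

theorem proposition4p2:
  shows
    "(\<forall>(n::nat) (\<beta>::real) (\<omega>::real) (c::real) (\<theta>::nat \<Rightarrow> real).
        n \<ge> 2 \<longrightarrow> \<beta> \<ge> 0 \<longrightarrow> twisted n \<omega> c \<theta> \<longrightarrow>
          (rope_equilibrium n \<beta> \<omega> \<theta> \<longleftrightarrow> resonant n \<omega>) \<and>
          ((\<exists>k::int. odd k \<and> \<omega> = pi * of_int k) \<longrightarrow> bipodal n \<theta>) \<and>
          ((\<exists>k::int. even k \<and> \<omega> = pi * of_int k) \<longrightarrow> consensus n \<theta>) \<and>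
          (\<not> resonant n \<omega> \<longrightarrow> \<omega> \<notin> int_multiples (2 * pi) \<longrightarrow>
             rope_max_speed n \<beta> \<omega> \<theta> \<le> \<bar>sin (real n * \<omega> / 2)\<bar> / (real n * \<bar>sin (\<omega> / 2)\<bar>) \<and>
             \<bar>sin (real n * \<omega> / 2)\<bar> / (real n * \<bar>sin (\<omega> / 2)\<bar>) \<le> 1 / (real n * \<bar>sin (\<omega> / 2)\<bar>)))
     \<and>
     (\<forall>\<omega>::real. \<omega> \<notin> int_multiples (2 * pi) \<longrightarrow>
        (\<lambda>n::nat. 1 / (real n * \<bar>sin (\<omega> / 2)\<bar>)) \<in> O(\<lambda>n. 1 / real n) \<and>
        (\<exists>C::real. \<forall>(n::nat) (\<beta>::real) (c::real) (\<theta>::nat \<Rightarrow> real).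
           n \<ge> 2 \<longrightarrow> \<beta> \<ge> 0 \<longrightarrow> twisted n \<omega> c \<theta> \<longrightarrow> \<not> resonant n \<omega> \<longrightarrow>
             rope_max_speed n \<beta> \<omega> \<theta> \<le> C / real n))
     \<and>
     (\<forall>(\<beta>::real) (c::real). \<beta> \<ge> 0 \<longrightarrow>
        \<not> (\<exists>(C::real) (\<epsilon>::real). \<epsilon> > 0 \<and>
             (\<forall>(n::nat) (\<omega>::real) (\<theta>::nat \<Rightarrow> real).
                n \<ge> 2 \<longrightarrow> \<not> resonant n \<omega> \<longrightarrow> infdist \<omega> (int_multiples (2 * pi)) < \<epsilon> \<longrightarrow>
                twisted n \<omega> c \<theta> \<longrightarrow> rope_max_speed n \<beta> \<omega> \<theta> \<le> C / real n)))"
proof (intro conjI allI impI, goal_cases)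
  case (1 n \<beta> \<omega> c \<theta>)
  then show ?case
    by (intro twisted_equilibrium_iff)
next
  case (2 n \<beta> \<omega> c \<theta>)
  then show ?case
    by (auto intro: twisted_odd_bipodal)
next
  case (3 n \<beta> \<omega> c \<theta>)
  then show ?case
    by (auto intro: twisted_even_consensus)
next
  case (4 n \<beta> \<omega> c \<theta>)
  then show ?case
    by (intro twisted_max_speed_le) (auto simp: int_multiples_two_pi_iff)
next
  case (5 n \<beta> \<omega> c \<theta>)
  show ?case
    by (rule abs_sin_divide_le) simp
next
  case (6 \<omega>)
  show ?case
    by (rule bigoI[of _ "1 / \<bar>sin (\<omega> / 2)\<bar>"]) (simp add: mult.commute)
next
  case (7 \<omega>)
  have "rope_max_speed n \<beta> \<omega> \<theta> \<le> (1 / \<bar>sin (\<omega> / 2)\<bar>) / real n"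
    if "n \<ge> 2" "twisted n \<omega> c \<theta>" for n \<beta> c \<theta>
  proof -
    have "rope_max_speed n \<beta> \<omega> \<theta> \<le> \<bar>sin (real n * \<omega> / 2)\<bar> / (real n * \<bar>sin (\<omega> / 2)\<bar>)"
      using 7 that by (intro twisted_max_speed_le) (auto simp: int_multiples_two_pi_iff)
    also have "\<dots> \<le> 1 / (real n * \<bar>sin (\<omega> / 2)\<bar>)"
      by (rule abs_sin_divide_le) simp
    finally show ?thesis
      by (simp add: mult.commute)
  qed
  then show ?case
    by blast
next
  case (8 \<beta> c)
  show ?case
    using no_uniform_speed_bound[of _ c _ \<beta>] by (meson not_le)
qed

end
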